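(* Let $m,n\in\mathbb{N}$ with $m$ even, and let $\mathcal{A}$ be a real symmetric tensor of order $m$ and dimension $n$ that has an SOS tensor decomposition. Then $\mathrm{SOSrank}(\mathcal{A})\le\Lambda$, where $\Lambda=\frac{\sqrt{1+8a}-1}{2}$ and $a=\binom{n+m-1}{m}$. In particular, $\text{SOS-width}(\mathrm{SOS}_{m,n})\le\Lambda$.
   Context: A real tensor of order $m$ and dimension $n$ is an array $\mathcal{A}=(a_{i_1\cdots i_m})$ with $i_1,\dots,i_m\in[n]=\{1,\dots,n\}$; it is symmetric if its entries are invariant under permutations of the indices. Its associated form is $f_{\mathcal{A}}(\mathbf{x})=\mathcal{A}\mathbf{x}^m=\sum_{i_1,\dots,i_m\in[n]}a_{i_1\cdots i_m}x_{i_1}\cdots x_{i_m}$. For even $m$, $\mathcal{A}$ has an SOS tensor decomposition if $f_{\mathcal{A}}$ is a finite sum of squares of real polynomials (equivalently, of homogeneous polynomials of degree $m/2$); $\mathrm{SOS}_{m,n}$ is the cone of all symmetric tensors of order $m$ and dimension $n$ having an SOS tensor decomposition. For $\mathcal{A}\in\mathrm{SOS}_{m,n}$, $\mathrm{SOSrank}(\mathcal{A})$ is the minimum $r$ such that $f_{\mathcal{A}}=f_1^2+\cdots+f_r^2$ with $f_i$ real homogeneous polynomials of degree $m/2$. For a convex cone $C\subseteq\mathrm{SOS}_{m,n}$, $\text{SOS-width}(C)=\sup\{\mathrm{SOSrank}(\mathcal{A}):\mathcal{A}\in C\}$. *)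

theory Defs
  imports
    "HOL-Analysis.Analysis"
    "HOL-Library.Poly_Mapping"
    "HOL-Library.Extended_Real"
    "HOL-Combinatorics.Permutations"
begin

text \<open>
  Real polynomials are finitely supported coefficient functions on exponent vectors; the product
  is the convolution product of \<^theory>\<open>HOL-Library.Poly_Mapping\<close>.
\<close>

type_synonym real_mpoly = "(nat \<Rightarrow>\<^sub>0 nat) \<Rightarrow>\<^sub>0 real"

definition Const :: "real \<Rightarrow> real_mpoly" where
  "Const c = Poly_Mapping.single 0 c"

definition Var :: "nat \<Rightarrow> real_mpoly" where
  "Var i = Poly_Mapping.single (Poly_Mapping.single i 1) 1"

text \<open>The ring \<open>\<real>[x\<^sub>1, \<dots>, x\<^sub>n]\<close> as a subset of the polynomials in countably many variables.\<close>

definition polynomials :: "nat \<Rightarrow> real_mpoly set" where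
  "polynomials n = {p. \<forall>t\<in>Poly_Mapping.keys p. Poly_Mapping.keys t \<subseteq> {1..n}}"

text \<open>As usual, the zero polynomial counts as homogeneous of every degree.\<close>

definition homogeneous_polynomials :: "nat \<Rightarrow> nat \<Rightarrow> real_mpoly set" where
  "homogeneous_polynomials d n =
     {p \<in> polynomials n. \<forall>t\<in>Poly_Mapping.keys p.
        (\<Sum>i\<in>Poly_Mapping.keys t. Poly_Mapping.lookup t i) = d}"

definition index_tuples :: "nat \<Rightarrow> nat \<Rightarrow> nat list set" where
  "index_tuples m n = {is. length is = m \<and> set is \<subseteq> {1..n}}"

text \<open>
  A tensor is a function on index tuples. It is normalised to be \<open>0\<close> outside \<open>[n]\<^sup>m\<close>, so that
  every array has exactly one representative.
\<close>

definition tensors :: "nat \<Rightarrow> nat \<Rightarrow> (nat list \<Rightarrow> real) set" where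
  "tensors m n = {A. \<forall>is. is \<notin> index_tuples m n \<longrightarrow> A is = 0}"

definition symmetric_tensors :: "nat \<Rightarrow> nat \<Rightarrow> (nat list \<Rightarrow> real) set" where
  "symmetric_tensors m n =
     {A \<in> tensors m n. \<forall>is\<in>index_tuples m n. \<forall>\<sigma>. \<sigma> permutes {..<m} \<longrightarrow>
        A (permute_list \<sigma> is) = A is}"

definition assoc_form :: "nat \<Rightarrow> nat \<Rightarrow> (nat list \<Rightarrow> real) \<Rightarrow> real_mpoly" where
  "assoc_form m n A = (\<Sum>is\<in>index_tuples m n. Const (A is) * (\<Prod>j<m. Var (is ! j)))"

text \<open>The summands are arbitrary polynomials here; homogeneity is only required for the rank.\<close>

definition has_SOS_decomposition :: "nat \<Rightarrow> nat \<Rightarrow> (nat list \<Rightarrow> real) \<Rightarrow> bool" where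
  "has_SOS_decomposition m n A \<longleftrightarrow>
     (\<exists>(r::nat) f. (\<forall>i<r. f i \<in> polynomials n) \<and> assoc_form m n A = (\<Sum>i<r. (f i)\<^sup>2))"

definition SOS_tensors :: "nat \<Rightarrow> nat \<Rightarrow> (nat list \<Rightarrow> real) set" where
  "SOS_tensors m n = {A \<in> symmetric_tensors m n. has_SOS_decomposition m n A}"

text \<open>Only meaningful for \<open>A \<in> SOS_tensors m n\<close> with \<open>m\<close> even.\<close>

definition SOS_rank :: "nat \<Rightarrow> nat \<Rightarrow> (nat list \<Rightarrow> real) \<Rightarrow> nat" where
  "SOS_rank m n A =
     (LEAST r. \<exists>f. (\<forall>i<r. f i \<in> homogeneous_polynomials (m div 2) n) \<and>
        assoc_form m n A = (\<Sum>i<r. (f i)\<^sup>2))"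

text \<open>
  Intended for convex cones \<open>C \<subseteq> SOS_tensors m n\<close>. The supremum is taken in the extended reals, so
  that it is \<open>\<infinity>\<close> when the ranks are unbounded.
\<close>

definition SOS_width :: "nat \<Rightarrow> nat \<Rightarrow> (nat list \<Rightarrow> real) set \<Rightarrow> ereal" where
  "SOS_width m n C = (SUP A\<in>C. ereal (real (SOS_rank m n A)))"

end

theory Submission
  imports Defs
begin

text \<open>
  Let \<open>F = f\<^sub>1\<^sup>2 + \<dots> + f\<^sub>r\<^sup>2\<close> with \<open>r\<close> minimal. If the \<open>r (r + 1) / 2\<close> products \<open>f\<^sub>i f\<^sub>j\<close> were more than
  the \<open>a\<close> monomials of degree \<open>m\<close>, they would satisfy a linear relation, that is, \<open>f\<^sup>T B f = 0\<close> for a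
  symmetric matrix \<open>B \<noteq> 0\<close>. Then \<open>F = f\<^sup>T (I + t B) f\<close> for all \<open>t\<close>. For a suitable \<open>t\<close> the matrix
  \<open>I + t B\<close> is positive semidefinite and singular, and a factorization \<open>L\<^sup>T L\<close> of it with \<open>r - 1\<close> rows
  writes \<open>F\<close> as a sum of \<open>r - 1\<close> squares. Hence \<open>r (r + 1) / 2 \<le> a\<close>.
\<close>

subsection \<open>Positive semidefinite matrices\<close>

definition quadratic_form :: "'i set \<Rightarrow> ('i \<Rightarrow> 'i \<Rightarrow> real) \<Rightarrow> ('i \<Rightarrow> real) \<Rightarrow> real" where
  "quadratic_form I M x = (\<Sum>i\<in>I. \<Sum>j\<in>I. M i j * x i * x j)"

definition pos_semidef :: "'i set \<Rightarrow> ('i \<Rightarrow> 'i \<Rightarrow> real) \<Rightarrow> bool" where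
  "pos_semidef I M \<longleftrightarrow> (\<forall>i\<in>I. \<forall>j\<in>I. M i j = M j i) \<and> (\<forall>x. 0 \<le> quadratic_form I M x)"

lemma pos_semidef_sym: "pos_semidef I M \<Longrightarrow> i \<in> I \<Longrightarrow> j \<in> I \<Longrightarrow> M i j = M j i"
  by (auto simp: pos_semidef_def)

lemma pos_semidef_nonneg: "pos_semidef I M \<Longrightarrow> 0 \<le> quadratic_form I M x"
  by (auto simp: pos_semidef_def)

lemma quadratic_form_shift:
  assumes "finite I" "\<And>i j. i \<in> I \<Longrightarrow> j \<in> I \<Longrightarrow> M i j = M j i" "k \<in> I"
  shows "quadratic_form I M (\<lambda>i. v i + (if i = k then s else 0)) =
    quadratic_form I M v + 2 * s * (\<Sum>j\<in>I. M k j * v j) + s\<^sup>2 * M k k"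
proof -
  define e where "e = (\<lambda>i. if i = k then s else 0)"
  have e1: "(\<Sum>i\<in>I. g i * e i) = s * g k" for g
    using assms by (simp add: e_def if_distrib[of "\<lambda>x. _ * x"] sum.delta cong: if_cong)
  have "quadratic_form I M (\<lambda>i. v i + e i) = quadratic_form I M v
     + (\<Sum>i\<in>I. \<Sum>j\<in>I. (M i j * v i) * e j) + (\<Sum>i\<in>I. \<Sum>j\<in>I. M i j * e i * v j)
     + (\<Sum>i\<in>I. \<Sum>j\<in>I. (M i j * e i) * e j)"
    unfolding quadratic_form_def sum.distrib[symmetric]
    by (intro sum.cong refl) (simp add: algebra_simps)
  also have "(\<Sum>i\<in>I. \<Sum>j\<in>I. (M i j * v i) * e j) = s * (\<Sum>j\<in>I. M k j * v j)"
    unfolding e1 sum_distrib_left using assms by (intro sum.cong refl) auto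
  also have "(\<Sum>i\<in>I. \<Sum>j\<in>I. M i j * e i * v j) = (\<Sum>i\<in>I. (\<Sum>j\<in>I. M i j * v j) * e i)"
    by (simp add: sum_distrib_left sum_distrib_right mult_ac)
  also have "\<dots> = s * (\<Sum>j\<in>I. M k j * v j)"
    by (rule e1)
  also have "(\<Sum>i\<in>I. \<Sum>j\<in>I. (M i j * e i) * e j) = s\<^sup>2 * M k k"
    unfolding e1 by (simp only: mult.assoc[symmetric] e1) (simp add: power2_eq_square)
  finally show ?thesis by (simp add: e_def)
qed

text \<open>For small \<open>s\<close> the linear term dominates the quadratic one and changes sign
  with \<open>s\<close>.\<close>

lemma linear_coeff_zero_of_nonneg:
  fixes b c :: real
  assumes "\<And>s. 0 \<le> 2 * s * b + s\<^sup>2 * c"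
  shows "b = 0"
proof (rule ccontr)
  assume b: "b \<noteq> 0"
  \<comment> \<open>The sign is opposite to that of \<open>b\<close>; the denominator is never zero
    and makes \<open>c - 2 * (\<bar>c\<bar> + 1)\<close> negative for every
    \<open>c\<close>.\<close>
  define t where "t = - b / (\<bar>c\<bar> + 1)"
  have "2 * t * b + t\<^sup>2 * c = b\<^sup>2 / (\<bar>c\<bar> + 1)\<^sup>2 * (c - 2 * (\<bar>c\<bar> + 1))"
    unfolding t_def by (simp add: divide_simps power2_eq_square) (simp add: algebra_simps)
  also have "\<dots> < 0"
    using b by (intro mult_pos_neg divide_pos_pos) (auto simp: zero_less_power2)
  finally show False using assms[of t] by linarith
qed

text \<open>The vector \<open>v\<close> minimizes a nonnegative form, so the gradient
  \<open>2 M v\<close> vanishes there.\<close>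

lemma pos_semidef_kernel:
  assumes "finite I" "pos_semidef I M" "quadratic_form I M v = 0" "k \<in> I"
  shows "(\<Sum>j\<in>I. M k j * v j) = 0"
proof (rule linear_coeff_zero_of_nonneg)
  fix s
  have "quadratic_form I M (\<lambda>i. v i + (if i = k then s else 0)) =
      quadratic_form I M v + 2 * s * (\<Sum>j\<in>I. M k j * v j) + s\<^sup>2 * M k k"
    using assms(1) pos_semidef_sym[OF assms(2)] assms(4) by (rule quadratic_form_shift)
  then show "0 \<le> 2 * s * (\<Sum>j\<in>I. M k j * v j) + s\<^sup>2 * M k k"
    using assms(3) pos_semidef_nonneg[OF assms(2), of "\<lambda>i. v i + (if i = k then s else 0)"]
    by linarith
qed

lemma quadratic_form_insert:
  assumes "finite I" "k \<notin> I" "\<And>i. i \<in> I \<Longrightarrow> M i k = M k i"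
  shows "quadratic_form (insert k I) M x =
    quadratic_form I M x + 2 * x k * (\<Sum>i\<in>I. M k i * x i) + M k k * (x k)\<^sup>2"
proof -
  have "(\<Sum>i\<in>I. M i k * x i * x k) = x k * (\<Sum>i\<in>I. M k i * x i)"
    unfolding sum_distrib_left using assms by (intro sum.cong) auto
  moreover have "(\<Sum>j\<in>I. M k j * x k * x j) = x k * (\<Sum>i\<in>I. M k i * x i)"
    unfolding sum_distrib_left by (intro sum.cong) auto
  ultimately show ?thesis
    using assms unfolding quadratic_form_def
    by (simp add: sum.distrib power2_eq_square)
qed

lemma quadratic_form_cong:
  "(\<And>i. i \<in> I \<Longrightarrow> x i = y i) \<Longrightarrow> quadratic_form I M x = quadratic_form I M y"
  by (simp add: quadratic_form_def)

lemma pos_semidef_restrict: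
  assumes "finite I" "k \<notin> I" "pos_semidef (insert k I) M"
  shows "pos_semidef I M"
  unfolding pos_semidef_def
proof (intro conjI ballI allI)
  fix x
  have "0 \<le> quadratic_form (insert k I) M (x(k := 0))"
    using assms by (simp add: pos_semidef_nonneg)
  also have "\<dots> = quadratic_form I M (x(k := 0))"
    using assms pos_semidef_sym[OF assms(3)] by (subst quadratic_form_insert) auto
  also have "\<dots> = quadratic_form I M x"
    using assms by (intro quadratic_form_cong) auto
  finally show "0 \<le> quadratic_form I M x" .
qed (use pos_semidef_sym[OF assms(3)] in auto)

text \<open>The form of the Schur complement at \<open>x\<close> is the minimum of the large form
  over the free coordinate \<open>k\<close>, hence nonnegative.\<close>

lemma pos_semidef_schur_complement:
  assumes "finite I" "k \<notin> I" "pos_semidef (insert k I) M" "M k k > 0"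
  shows "pos_semidef I (\<lambda>i j. M i j - M k i * M k j / M k k)"
  unfolding pos_semidef_def
proof (intro conjI ballI allI)
  fix x
  define b where "b = (\<Sum>i\<in>I. M k i * x i)"
  \<comment> \<open>This value minimizes \<open>2 * s * b + M k k * s^2\<close> over
    \<open>s\<close>; the minimum is \<open>- b^2 / M k k\<close>.\<close>
  define y where "y = x(k := - b / M k k)"
  have "quadratic_form I M y = quadratic_form I M x" "(\<Sum>i\<in>I. M k i * y i) = b"
    using assms(2) unfolding y_def b_def
    by (auto intro!: quadratic_form_cong sum.cong)
  moreover have "quadratic_form (insert k I) M y =
      quadratic_form I M y + 2 * y k * (\<Sum>i\<in>I. M k i * y i) + M k k * (y k)\<^sup>2"
    using assms pos_semidef_sym[OF assms(3)] by (subst quadratic_form_insert) auto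
  ultimately have "quadratic_form (insert k I) M y =
      quadratic_form I M x + 2 * y k * b + M k k * (y k)\<^sup>2"
    by simp
  also have "\<dots> = quadratic_form I M x - b\<^sup>2 / M k k"
    using assms(4) by (simp add: y_def field_simps power2_eq_square)
  also have "b\<^sup>2 / M k k = (\<Sum>i\<in>I. \<Sum>j\<in>I. M k i * M k j / M k k * x i * x j)"
    by (simp add: b_def power2_eq_square sum_product sum_divide_distrib mult_ac)
  finally show "0 \<le> quadratic_form I (\<lambda>i j. M i j - M k i * M k j / M k k) x"
    using pos_semidef_nonneg[OF assms(3), of y]
    by (simp add: quadratic_form_def sum_subtractf left_diff_distrib)
qed (use pos_semidef_sym[OF assms(3)] in \<open>auto simp: mult.commute\<close>)

text \<open>The unit vector at \<open>k\<close> has form value \<open>M k k = 0\<close>, so it lies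
  in the kernel of \<open>M\<close>; its image is column \<open>k\<close>.\<close>

lemma pos_semidef_zero_diagonal:
  assumes "finite I" "pos_semidef I M" "k \<in> I" "M k k = 0" "i \<in> I"
  shows "M i k = 0"
proof -
  define e where "e = (\<lambda>i. if i = k then 1 else 0 :: real)"
  have *: "(\<Sum>i\<in>I. g i * e i) = g k" for g
    using assms by (simp add: e_def if_distrib[of "\<lambda>x. _ * x"] sum.delta cong: if_cong)
  have "quadratic_form I M e = 0"
    unfolding quadratic_form_def * by (simp add: * assms)
  from pos_semidef_kernel[OF assms(1,2) this assms(5)] show ?thesis
    by (simp add: *)
qed

text \<open>Cholesky factorization by induction on the index set: a zero pivot has a zero row and
  column, while a positive pivot is split off and the Schur complement is factored. Indexing the
  rows of \<open>L\<close> by \<open>I\<close> fixes their number.\<close>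

lemma pos_semidef_gram:
  assumes "finite I" "pos_semidef I M"
  shows "\<exists>L. \<forall>i\<in>I. \<forall>j\<in>I. M i j = (\<Sum>l\<in>I. L l i * L l j)"
  using assms
proof (induction I arbitrary: M rule: finite_induct)
  case empty
  show ?case by simp
next
  case (insert k I)
  note sym = pos_semidef_sym[OF insert.prems]
  have kk: "M k k \<ge> 0"
  proof -
    have "0 \<le> quadratic_form (insert k I) M ((\<lambda>_. 0)(k := 1))"
      using insert by (simp add: pos_semidef_nonneg)
    also have "\<dots> = quadratic_form I M ((\<lambda>_. 0)(k := 1)) + M k k"
      using insert.hyps sym by (subst quadratic_form_insert) (auto intro!: sum.neutral)
    also have "quadratic_form I M ((\<lambda>_. 0)(k := 1)) = quadratic_form I M (\<lambda>_. 0)"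
      using insert.hyps by (intro quadratic_form_cong) auto
    finally show ?thesis by (simp add: quadratic_form_def)
  qed
  show ?case
  proof (cases "M k k = 0")
    case True
    then have 0: "M i k = 0" "M k i = 0" if "i \<in> I" for i
      using pos_semidef_zero_diagonal[OF _ insert.prems, of k i] insert.hyps sym that by auto
    obtain L where L: "\<forall>i\<in>I. \<forall>j\<in>I. M i j = (\<Sum>l\<in>I. L l i * L l j)"
      using insert.IH pos_semidef_restrict[OF insert.hyps insert.prems] by blast
    have "\<forall>i\<in>insert k I. \<forall>j\<in>insert k I. M i j =
        (\<Sum>l\<in>insert k I. (if l = k \<or> i = k then 0 else L l i) * (if l = k \<or> j = k then 0 else L l j))"
      using insert.hyps L True 0 by (auto intro!: sum.cong)
    then show ?thesis
      by (intro exI[of _ "\<lambda>l i. if l = k \<or> i = k then 0 else L l i"])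
  next
    case False
    with kk have pos: "M k k > 0" by simp
    obtain L where L: "\<forall>i\<in>I. \<forall>j\<in>I. M i j - M k i * M k j / M k k = (\<Sum>l\<in>I. L l i * L l j)"
      using insert.IH[OF pos_semidef_schur_complement[OF insert.hyps insert.prems pos]] by blast
    \<comment> \<open>The new row \<open>k\<close> contributes the rank-one matrix subtracted in the
      Schur complement; the old rows get a zero in column \<open>k\<close>.\<close>
    define L' where "L' = (\<lambda>l i. if l = k then M k i / sqrt (M k k) else if i = k then 0 else L l i)"
    have k: "L' k i * L' k j = M k i * M k j / M k k" for i j
      using pos by (simp add: L'_def)
    have I: "(\<Sum>l\<in>I. L' l i * L' l j) = (if i = k \<or> j = k then 0 else \<Sum>l\<in>I. L l i * L l j)" for i j
      using insert.hyps by (auto simp: L'_def intro!: sum.cong sum.neutral)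
    have "M i j = (\<Sum>l\<in>insert k I. L' l i * L' l j)"
      if ij: "i \<in> insert k I" "j \<in> insert k I" for i j
    proof -
      have "(\<Sum>l\<in>insert k I. L' l i * L' l j) =
          M k i * M k j / M k k + (if i = k \<or> j = k then 0 else \<Sum>l\<in>I. L l i * L l j)"
        using insert.hyps by (simp add: k I)
      also have "\<dots> = M i j"
      proof (cases "i = k \<or> j = k")
        case True
        then show ?thesis using pos sym[OF ij] by auto
      next
        case False
        then have "i \<in> I" "j \<in> I" using ij by auto
        with L have "M i j - M k i * M k j / M k k = (\<Sum>l\<in>I. L l i * L l j)" by blast
        with False show ?thesis by simp
      qed
      finally show ?thesis ..
    qed
    then show ?thesis by blast
  qed
qed

text \<open>The principal submatrix on \<open>I - {k}\<close> already has a factor with one row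
  fewer. As \<open>v k\<close> is nonzero, \<open>M v = 0\<close> expresses column \<open>k\<close>
  of \<open>M\<close> through the other columns, and the same combination of columns of
  \<open>L\<close> gives its missing column.\<close>

lemma pos_semidef_singular_gram:
  assumes "finite I" "pos_semidef I M" "quadratic_form I M v = 0" "k \<in> I" "v k \<noteq> 0"
  shows "\<exists>L. \<forall>i\<in>I. \<forall>j\<in>I. M i j = (\<Sum>l\<in>I - {k}. L l i * L l j)"
proof -
  define J where "J = I - {k}"
  have J: "finite J" "k \<notin> J" "I = insert k J"
    using assms by (auto simp: J_def)
  note sym = pos_semidef_sym[OF assms(2)]
  obtain L where L: "\<forall>i\<in>J. \<forall>j\<in>J. M i j = (\<Sum>l\<in>J. L l i * L l j)"
    using pos_semidef_gram[of J M] pos_semidef_restrict[of J k M] J assms(2) by auto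
  have row: "M i k = - (\<Sum>j\<in>J. M i j * v j) / v k" if "i \<in> I" for i
  proof -
    have "(\<Sum>j\<in>I. M i j * v j) = 0"
      using pos_semidef_kernel[OF assms(1-3) that] .
    then have "M i k * v k + (\<Sum>j\<in>J. M i j * v j) = 0" using J by simp
    then show ?thesis using assms(5) by (simp add: field_simps)
  qed
  \<comment> \<open>Column \<open>k\<close> is chosen to solve \<open>L' v = 0\<close>.\<close>
  define L' where "L' = (\<lambda>l i. if i = k then - (\<Sum>j\<in>J. L l j * v j) / v k else L l i)"
  have jj: "M i j = (\<Sum>l\<in>J. L' l i * L' l j)" if "i \<in> J" "j \<in> J" for i j
    using L that J(2) by (auto simp: L'_def intro!: sum.cong)
  \<comment> \<open>Since \<open>L' v = 0\<close>, the Gram matrix of \<open>L'\<close> obeys the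
    same relation between its columns as \<open>M\<close> does in \<open>row\<close>; this includes
    \<open>i = k\<close>.\<close>
  have swap: "- (\<Sum>j\<in>J. (\<Sum>l\<in>J. L' l i * L' l j) * v j) / v k = (\<Sum>l\<in>J. L' l i * L' l k)" for i
  proof -
    have "(\<Sum>j\<in>J. (\<Sum>l\<in>J. L' l i * L' l j) * v j) = (\<Sum>l\<in>J. \<Sum>j\<in>J. L' l i * L' l j * v j)"
      unfolding sum_distrib_right by (rule sum.swap)
    also have "\<dots> = (\<Sum>l\<in>J. L' l i * (\<Sum>j\<in>J. L' l j * v j))"
      by (simp add: sum_distrib_left mult.assoc)
    also have "\<dots> = (\<Sum>l\<in>J. L' l i * (- v k * L' l k))"
    proof (intro sum.cong refl arg_cong[of _ _ "\<lambda>x. _ * x"])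
      fix l
      have "(\<Sum>j\<in>J. L' l j * v j) = (\<Sum>j\<in>J. L l j * v j)"
        using J(2) by (intro sum.cong) (auto simp: L'_def)
      then show "(\<Sum>j\<in>J. L' l j * v j) = - v k * L' l k"
        using assms(5) by (simp add: L'_def)
    qed
    also have "\<dots> = - v k * (\<Sum>l\<in>J. L' l i * L' l k)"
      by (simp add: sum_distrib_left mult_ac sum_negf)
    finally show ?thesis using assms(5) by simp
  qed
  have jk: "M i k = (\<Sum>l\<in>J. L' l i * L' l k)" if "i \<in> J" for i
  proof -
    have "M i k = - (\<Sum>j\<in>J. (\<Sum>l\<in>J. L' l i * L' l j) * v j) / v k"
      using row[of i] jj that J by simp
    then show ?thesis by (simp only: swap)
  qed
  have kj: "M k j = (\<Sum>l\<in>J. L' l k * L' l j)" if "j \<in> J" for j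
    using jk[OF that] sym[of k j] that J by (simp add: mult.commute)
  \<comment> \<open>The diagonal entry comes last: \<open>row\<close> at \<open>k\<close> involves
    the entries \<open>M k j\<close>, known from \<open>M j k\<close> by symmetry.\<close>
  have kk: "M k k = (\<Sum>l\<in>J. L' l k * L' l k)"
  proof -
    have "M k k = - (\<Sum>j\<in>J. (\<Sum>l\<in>J. L' l k * L' l j) * v j) / v k"
      using row[of k] kj J by simp
    then show ?thesis by (simp only: swap)
  qed
  from jj jk kj kk show ?thesis
    unfolding J_def[symmetric] using J(3) by blast
qed

section \<open>Maximizing a quadratic form on the unit sphere\<close>

lemma compact_unit_sphere_fun:
  assumes "finite I"
  shows "compact {x::'i \<Rightarrow> real. (\<forall>i. i \<notin> I \<longrightarrow> x i = 0) \<and> (\<Sum>i\<in>I. (x i)\<^sup>2) = 1}"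
proof -
  \<comment> \<open>Fixing the coordinates outside \<open>I\<close> at zero puts the sphere inside a
    product of compact sets, where Tychonoff's theorem applies.\<close>
  define C where "C = (PiE UNIV (\<lambda>i. if i \<in> I then {-1..1} else {0}) :: ('i \<Rightarrow> real) set)"
  have "compactin (product_topology (\<lambda>_. euclidean) UNIV) C"
    unfolding C_def compactin_PiE by auto
  then have "compact C" by (simp add: euclidean_product_topology)
  moreover have "closed {x::'i \<Rightarrow> real. (\<Sum>i\<in>I. (x i)\<^sup>2) = 1}"
    by (intro closed_Collect_eq continuous_intros continuous_on_product_coordinates)
  moreover have "{x::'i \<Rightarrow> real. (\<forall>i. i \<notin> I \<longrightarrow> x i = 0) \<and> (\<Sum>i\<in>I. (x i)\<^sup>2) = 1} =
      C \<inter> {x. (\<Sum>i\<in>I. (x i)\<^sup>2) = 1}"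
  proof -
    have "\<bar>x i\<bar> \<le> 1" if "(\<Sum>i\<in>I. (x i)\<^sup>2) = 1" "i \<in> I" for x :: "'i \<Rightarrow> real" and i
      using member_le_sum[of i I "\<lambda>i. (x i)\<^sup>2"] assms that by (simp add: abs_square_le_1)
    then show ?thesis by (fastforce simp: C_def PiE_def Pi_def split: if_splits)
  qed
  ultimately show ?thesis by (simp add: compact_Int_closed)
qed

lemma quadratic_form_scale: "quadratic_form I M (\<lambda>i. c * x i) = c\<^sup>2 * quadratic_form I M x"
  by (simp add: quadratic_form_def sum_distrib_left power2_eq_square mult_ac)

text \<open>The number \<open>l\<close> is the maximum of the Rayleigh quotient, attained at
  \<open>v\<close> by compactness of the sphere; scaling carries the bound to all vectors.\<close>

lemma quadratic_form_attains_max: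
  fixes B :: "'i \<Rightarrow> 'i \<Rightarrow> real"
  assumes "finite I" "quadratic_form I B x > 0"
  shows "\<exists>v l. l > 0 \<and> quadratic_form I B v = l * (\<Sum>i\<in>I. (v i)\<^sup>2) \<and> (\<exists>k\<in>I. v k \<noteq> 0) \<and>
    (\<forall>y. quadratic_form I B y \<le> l * (\<Sum>i\<in>I. (y i)\<^sup>2))"
proof -
  define S where "S = {x::'i \<Rightarrow> real. (\<forall>i. i \<notin> I \<longrightarrow> x i = 0) \<and> (\<Sum>i\<in>I. (x i)\<^sup>2) = 1}"
  have norm: "\<exists>z\<in>S. quadratic_form I B y = (\<Sum>i\<in>I. (y i)\<^sup>2) * quadratic_form I B z"
    if "(\<Sum>i\<in>I. (y i)\<^sup>2) \<noteq> 0" for y :: "'i \<Rightarrow> real"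
  proof -
    define s where "s = (\<Sum>i\<in>I. (y i)\<^sup>2)"
    have s: "s > 0"
      using that sum_nonneg[of I "\<lambda>i. (y i)\<^sup>2"] by (simp add: s_def)
    define z where "z = (\<lambda>i. if i \<in> I then 1 / sqrt s * y i else 0)"
    have "(\<Sum>i\<in>I. (z i)\<^sup>2) = (\<Sum>i\<in>I. (y i)\<^sup>2 / s)"
      using s by (intro sum.cong) (auto simp: z_def power_divide)
    also have "\<dots> = 1" using s by (simp add: sum_divide_distrib[symmetric] s_def)
    finally have "z \<in> S" by (simp add: S_def z_def)
    moreover have "quadratic_form I B z = quadratic_form I B (\<lambda>i. 1 / sqrt s * y i)"
      by (intro quadratic_form_cong) (simp add: z_def)
    then have "quadratic_form I B y = s * quadratic_form I B z"
      unfolding quadratic_form_scale using s by (simp add: power_divide)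
    ultimately show ?thesis by (auto simp: s_def)
  qed
  have zero: "quadratic_form I B y = 0" if "(\<Sum>i\<in>I. (y i)\<^sup>2) = 0" for y
    using that assms(1) by (simp add: sum_nonneg_eq_0_iff quadratic_form_def)
  \<comment> \<open>Normalizing \<open>x\<close> shows that the sphere is nonempty and that the
    maximum is positive.\<close>
  obtain z where z: "z \<in> S" "quadratic_form I B x = (\<Sum>i\<in>I. (x i)\<^sup>2) * quadratic_form I B z"
    using norm[of x] zero[of x] assms(2) by force
  have zpos: "quadratic_form I B z > 0"
    using z(2) assms(2) sum_nonneg[of I "\<lambda>i. (x i)\<^sup>2"] by (simp add: zero_less_mult_iff)
  have "continuous_on S (quadratic_form I B)"
    unfolding quadratic_form_def
    by (intro continuous_intros continuous_on_subset[OF continuous_on_product_coordinates] subset_UNIV)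
  then obtain v where v: "v \<in> S" "\<forall>y\<in>S. quadratic_form I B y \<le> quadratic_form I B v"
    using continuous_attains_sup[of S] compact_unit_sphere_fun[OF assms(1)] z(1)
    unfolding S_def by blast
  have v1: "(\<Sum>i\<in>I. (v i)\<^sup>2) = 1" using v by (simp add: S_def)
  have "quadratic_form I B y \<le> quadratic_form I B v * (\<Sum>i\<in>I. (y i)\<^sup>2)" for y
  proof (cases "(\<Sum>i\<in>I. (y i)\<^sup>2) = 0")
    case False
    from norm[OF this] obtain w where
      w: "w \<in> S" "quadratic_form I B y = (\<Sum>i\<in>I. (y i)\<^sup>2) * quadratic_form I B w"
      by blast
    then show ?thesis
      using v(2) by (simp add: mult.commute[of "sum _ _"] mult_right_mono sum_nonneg)
  qed (simp add: zero)
  moreover have "\<exists>k\<in>I. v k \<noteq> 0"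
  proof (rule ccontr)
    assume "\<not> ?thesis"
    then have "(\<Sum>i\<in>I. (v i)\<^sup>2) = 0" by simp
    with v1 show False by simp
  qed
  moreover have "quadratic_form I B v > 0"
    using v(2) z(1) zpos by (meson less_le_trans)
  ultimately show ?thesis using v1 by (intro exI[of _ v] exI[of _ "quadratic_form I B v"]) auto
qed

text \<open>If the form vanished identically, \<open>B\<close> would be positive semidefinite with
  every vector in its kernel; the unit vector at \<open>l\<close> picks out
  \<open>B k l\<close>.\<close>

lemma quadratic_form_nonzero:
  assumes "finite I" "\<And>i j. i \<in> I \<Longrightarrow> j \<in> I \<Longrightarrow> B i j = B j i" "k \<in> I" "l \<in> I" "B k l \<noteq> 0"
  shows "\<exists>x. quadratic_form I B x \<noteq> 0"
proof (rule ccontr)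
  assume "\<not> ?thesis"
  then have 0: "quadratic_form I B x = 0" for x by simp
  then have "pos_semidef I B" using assms(2) by (simp add: pos_semidef_def)
  define e where "e = (\<lambda>i. if i = l then 1 else 0 :: real)"
  have "(\<Sum>j\<in>I. B k j * e j) = 0"
    by (rule pos_semidef_kernel[OF assms(1) \<open>pos_semidef I B\<close> 0 assms(3)])
  then show False
    using assms by (simp add: e_def if_distrib[of "\<lambda>x. _ * x"] sum.delta cong: if_cong)
qed

text \<open>Moving from the identity matrix in the direction \<open>B\<close> or \<open>- B\<close>, one leaves the cone of positive
  semidefinite matrices at a singular matrix, which is a Gram matrix of rank less than \<open>card I\<close>.\<close>

lemma singular_perturbation_gram:
  fixes B :: "'i \<Rightarrow> 'i \<Rightarrow> real"
  assumes "finite I" "\<And>i j. i \<in> I \<Longrightarrow> j \<in> I \<Longrightarrow> B i j = B j i" "i0 \<in> I" "j0 \<in> I" "B i0 j0 \<noteq> 0"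
  shows "\<exists>t. \<exists>k\<in>I. \<exists>L. \<forall>i\<in>I. \<forall>j\<in>I. (if i = j then 1 else 0) + t * B i j = (\<Sum>l\<in>I - {k}. L l i * L l j)"
proof -
  obtain x where x: "quadratic_form I B x \<noteq> 0"
    using quadratic_form_nonzero[OF assms] by blast
  \<comment> \<open>Passing to \<open>- B\<close> if necessary makes the form positive
    somewhere.\<close>
  define c :: real where "c = (if quadratic_form I B x > 0 then 1 else -1)"
  have scale: "quadratic_form I (\<lambda>i j. c * B i j) y = c * quadratic_form I B y" for y
    by (simp add: quadratic_form_def sum_distrib_left mult_ac)
  have "quadratic_form I (\<lambda>i j. c * B i j) x > 0"
    unfolding scale using x by (auto simp: c_def)
  from quadratic_form_attains_max[OF assms(1) this] obtain v l k where
    v: "l > 0" "c * quadratic_form I B v = l * (\<Sum>i\<in>I. (v i)\<^sup>2)" "k \<in> I" "v k \<noteq> 0"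
      "\<And>y. c * quadratic_form I B y \<le> l * (\<Sum>i\<in>I. (y i)\<^sup>2)"
    unfolding scale by blast
  \<comment> \<open>Now \<open>M\<close> is the identity minus \<open>c * B / l\<close>; its form is
    nonnegative by maximality of \<open>l\<close> and vanishes at the maximizer
    \<open>v\<close>.\<close>
  define t where "t = - c / l"
  define M where "M = (\<lambda>i j. (if i = j then 1 else 0) + t * B i j)"
  have M: "quadratic_form I M y = ((\<Sum>i\<in>I. (y i)\<^sup>2) * l - c * quadratic_form I B y) / l" for y
  proof -
    have "(\<Sum>j\<in>I. (if i = j then 1 else 0) * y i * y j) = (y i)\<^sup>2" if "i \<in> I" for i
      using that assms(1)
      by (simp add: if_distrib[of "\<lambda>x. x * _"] sum.delta power2_eq_square cong: if_cong)
    then have "(\<Sum>i\<in>I. \<Sum>j\<in>I. (if i = j then 1 else 0) * y i * y j) = (\<Sum>i\<in>I. (y i)\<^sup>2)"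
      by simp
    moreover have "quadratic_form I M y =
        (\<Sum>i\<in>I. \<Sum>j\<in>I. (if i = j then 1 else 0) * y i * y j) + t * quadratic_form I B y"
      unfolding quadratic_form_def M_def
      by (simp add: distrib_right sum.distrib sum_distrib_left mult.assoc)
    ultimately show ?thesis using v(1) by (simp add: t_def field_simps)
  qed
  have "pos_semidef I M"
    unfolding pos_semidef_def M
    using v(1) v(5) assms(2) by (auto simp: M_def mult.commute)
  moreover have "quadratic_form I M v = 0"
    using v(2) by (simp add: M mult.commute)
  ultimately show ?thesis
    using pos_semidef_singular_gram[of I M v k] assms(1) v(3,4) unfolding M_def by blast
qed

section \<open>Homogeneous linear systems with fewer equations than unknowns\<close>

lemma underdetermined_system:
  fixes A :: "'p \<Rightarrow> 'k \<Rightarrow> 'f::field"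
  assumes "finite K" "finite P" "card K < card P"
  shows "\<exists>c. (\<exists>p\<in>P. c p \<noteq> 0) \<and> (\<forall>k\<in>K. (\<Sum>p\<in>P. c p * A p k) = 0)"
  using assms
proof (induction K arbitrary: P A rule: finite_induct)
  case empty
  then have "P \<noteq> {}" by auto
  then show ?case by (intro exI[of _ "\<lambda>_. 1"]) auto
next
  case (insert k K)
  show ?case
  proof (cases "\<forall>p\<in>P. A p k = 0")
    case True
    obtain c where "\<exists>p\<in>P. c p \<noteq> 0" "\<forall>j\<in>K. (\<Sum>p\<in>P. c p * A p j) = 0"
      using insert.IH[of P A] insert.prems insert.hyps by auto
    with True show ?thesis by (intro exI[of _ c]) auto
  next
    case False
    \<comment> \<open>Gaussian elimination: solving equation \<open>k\<close> for the unknown at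
      \<open>q\<close> leaves a system with one equation and one unknown fewer.\<close>
    then obtain q where q: "q \<in> P" "A q k \<noteq> 0" by blast
    define Q where "Q = P - {q}"
    have Q: "finite Q" "q \<notin> Q" "P = insert q Q"
      using insert.prems q by (auto simp: Q_def)
    obtain c where c: "\<exists>p\<in>Q. c p \<noteq> 0"
        "\<forall>j\<in>K. (\<Sum>p\<in>Q. c p * (A p j - A p k / A q k * A q j)) = 0"
      using insert.IH[of Q "\<lambda>p j. A p j - A p k / A q k * A q j"] insert.prems insert.hyps Q by auto
    define d where "d = c(q := - (\<Sum>p\<in>Q. c p * A p k) / A q k)"
    \<comment> \<open>This covers \<open>j = k\<close> as well, where every term on the right
      vanishes.\<close>
    have d: "(\<Sum>p\<in>P. d p * A p j) = (\<Sum>p\<in>Q. c p * (A p j - A p k / A q k * A q j))" for j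
    proof -
      have "(\<Sum>p\<in>Q. d p * A p j) = (\<Sum>p\<in>Q. c p * A p j)"
        using Q(2) by (intro sum.cong) (auto simp: d_def)
      moreover have "(\<Sum>p\<in>Q. c p * (A p j - A p k / A q k * A q j)) =
          (\<Sum>p\<in>Q. c p * A p j) - (\<Sum>p\<in>Q. c p * A p k) / A q k * A q j"
        by (simp add: right_diff_distrib sum_subtractf sum_divide_distrib sum_distrib_right mult.assoc)
      ultimately show ?thesis using Q by (simp add: d_def)
    qed
    have "\<exists>p\<in>P. d p \<noteq> 0" using c(1) Q by (auto simp: d_def)
    moreover have "(\<Sum>p\<in>P. d p * A p j) = 0" if "j \<in> insert k K" for j
      using that c(2) q by (auto simp: d)
    ultimately show ?thesis by blast
  qed
qed

subsection \<open>Homogeneous polynomials and sums of squares\<close>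

definition monomial_degree :: "(nat \<Rightarrow>\<^sub>0 nat) \<Rightarrow> nat" where
  "monomial_degree t = (\<Sum>i\<in>Poly_Mapping.keys t. Poly_Mapping.lookup t i)"

lemma monomial_degree_superset:
  assumes "finite I" "Poly_Mapping.keys t \<subseteq> I"
  shows "monomial_degree t = (\<Sum>i\<in>I. Poly_Mapping.lookup t i)"
  unfolding monomial_degree_def using assms
  by (intro sum.mono_neutral_left) (auto simp: not_in_keys_iff_lookup_eq_zero)

lemma monomial_degree_add: "monomial_degree (s + t) = monomial_degree s + monomial_degree t"
  using keys_add[of s t]
  by (simp add: monomial_degree_superset[of "Poly_Mapping.keys s \<union> Poly_Mapping.keys t"]
      lookup_add sum.distrib)

definition monomials :: "nat \<Rightarrow> nat \<Rightarrow> (nat \<Rightarrow>\<^sub>0 nat) set" where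
  "monomials d n = {t. Poly_Mapping.keys t \<subseteq> {1..n} \<and> monomial_degree t = d}"

lemma homogeneous_polynomials_iff:
  "p \<in> homogeneous_polynomials d n \<longleftrightarrow> Poly_Mapping.keys p \<subseteq> monomials d n"
  by (auto simp: homogeneous_polynomials_def polynomials_def monomials_def monomial_degree_def)

text \<open>Exponent lists of length \<open>n\<close> with sum \<open>d\<close> are counted by stars
  and bars; an injection into them suffices for the bound.\<close>

lemma finite_monomials: "finite (monomials d n)"
  and card_monomials_le: "card (monomials d n) \<le> (n + d - 1) choose d"
proof -
  define h where "h = (\<lambda>t::nat \<Rightarrow>\<^sub>0 nat. map (Poly_Mapping.lookup t) [1..<Suc n])"
  define X where "X = {l::nat list. length l = n \<and> sum_list l = d}"
  have inj: "inj_on h (monomials d n)"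
  proof (intro inj_onI poly_mapping_eqI)
    fix s t i
    assume st: "s \<in> monomials d n" "t \<in> monomials d n" "h s = h t"
    show "Poly_Mapping.lookup s i = Poly_Mapping.lookup t i"
    proof (cases "i \<in> {1..n}")
      case True
      with st(3) show ?thesis by (auto simp: h_def simp del: upt_Suc)
    next
      case False
      with st(1,2) show ?thesis
        unfolding monomials_def by (metis (mono_tags, lifting) mem_Collect_eq not_in_keys_iff_lookup_eq_zero subset_iff)
    qed
  qed
  have img: "h ` monomials d n \<subseteq> X"
  proof
    fix l assume "l \<in> h ` monomials d n"
    then obtain t where t: "t \<in> monomials d n" "l = h t" by blast
    then have "monomial_degree t = (\<Sum>i\<in>{1..n}. Poly_Mapping.lookup t i)"
      by (intro monomial_degree_superset) (auto simp: monomials_def)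
    with t show "l \<in> X"
      by (simp add: X_def h_def monomials_def interv_sum_list_conv_sum_set_nat
          atLeastLessThanSuc_atLeastAtMost del: upt_Suc)
  qed
  have fin: "finite X"
  proof (rule finite_subset)
    show "X \<subseteq> {l. set l \<subseteq> {..d} \<and> length l = n}"
      by (auto simp: X_def member_le_sum_list)
  qed (simp add: finite_lists_length_eq)
  show "finite (monomials d n)"
    using inj img fin by (metis finite_imageD finite_subset)
  show "card (monomials d n) \<le> (n + d - 1) choose d"
    using card_inj_on_le[OF inj img fin] card_length_sum_list[of n d]
    by (simp add: X_def add.commute)
qed

section \<open>Constants and closure properties of homogeneous polynomials\<close>

lemma Const_add: "Const (a + b) = Const a + Const b"
  and Const_mult: "Const (a * b) = Const a * Const b"
  and Const_0: "Const 0 = 0"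
  and Const_1: "Const 1 = 1"
  by (simp_all add: Const_def single_add mult_single)

lemma Const_sum: "Const (sum f I) = (\<Sum>i\<in>I. Const (f i))"
  by (induction I rule: infinite_finite_induct) (simp_all add: Const_0 Const_add)

lemma lookup_Const_mult: "Poly_Mapping.lookup (Const c * p) t = c * Poly_Mapping.lookup p t"
proof -
  have "Const c * p = Poly_Mapping.map ((*) c) p"
    by (simp add: Const_def mult_map_scale_conv_mult)
  then show ?thesis by (simp add: Poly_Mapping.map.rep_eq when_def)
qed

lemma homogeneous_polynomials_sum:
  assumes "\<And>i. i \<in> I \<Longrightarrow> f i \<in> homogeneous_polynomials d n"
  shows "sum f I \<in> homogeneous_polynomials d n"
  using assms keys_sum[of f I] unfolding homogeneous_polynomials_iff by blast

lemma homogeneous_polynomials_mult: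
  assumes "p \<in> homogeneous_polynomials d n" "q \<in> homogeneous_polynomials e n"
  shows "p * q \<in> homogeneous_polynomials (d + e) n"
proof -
  have "s + t \<in> monomials (d + e) n" if "s \<in> monomials d n" "t \<in> monomials e n" for s t
    using that keys_add[of s t] by (auto simp: monomials_def monomial_degree_add)
  with assms keys_mult[of p q] show ?thesis
    unfolding homogeneous_polynomials_iff by blast
qed

lemma Const_homogeneous: "Const c \<in> homogeneous_polynomials 0 n"
  by (auto simp: homogeneous_polynomials_iff Const_def monomials_def monomial_degree_def)

lemma Const_mult_homogeneous:
  "p \<in> homogeneous_polynomials d n \<Longrightarrow> Const c * p \<in> homogeneous_polynomials d n"
  using homogeneous_polynomials_mult[OF Const_homogeneous] by fastforce

lemma Var_homogeneous: "i \<in> {1..n} \<Longrightarrow> Var i \<in> homogeneous_polynomials 1 n"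
  by (auto simp: homogeneous_polynomials_iff Var_def monomials_def monomial_degree_def)

lemma assoc_form_homogeneous: "assoc_form m n A \<in> homogeneous_polynomials m n"
  unfolding assoc_form_def
proof (intro homogeneous_polynomials_sum Const_mult_homogeneous)
  fix "is" assume "is": "is \<in> index_tuples m n"
  have "(\<Prod>j<k. Var (is ! j)) \<in> homogeneous_polynomials k n" if "k \<le> m" for k
    using that
  proof (induction k)
    case 0
    show ?case using Const_homogeneous[of 1 n] by (simp add: Const_1)
  next
    case (Suc k)
    then have "is ! k \<in> set is" using "is" by (simp add: index_tuples_def)
    then have "is ! k \<in> {1..n}" using "is" by (auto simp: index_tuples_def)
    from homogeneous_polynomials_mult[OF _ Var_homogeneous[OF this]] Suc show ?case
      by fastforce
  qed
  then show "(\<Prod>j<m. Var (is ! j)) \<in> homogeneous_polynomials m n" by blast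
qed

text \<open>By the hypothesis, the only product of two terms of \<open>p\<close> that can reach the
  monomial \<open>t + t\<close> is the square of the term at \<open>t\<close>, so nothing cancels
  it. Such a \<open>t\<close> behaves like a vertex of the Newton polytope.\<close>

lemma lookup_square_extremal:
  fixes p :: real_mpoly
  assumes "\<And>u v. u \<in> Poly_Mapping.keys p \<Longrightarrow> v \<in> Poly_Mapping.keys p \<Longrightarrow> u + v = t + t \<Longrightarrow> u = t"
  shows "Poly_Mapping.lookup (p\<^sup>2) (t + t) = (Poly_Mapping.lookup p t)\<^sup>2"
proof -
  define a where "a = Poly_Mapping.single t (Poly_Mapping.lookup p t)"
  define q where "q = p - a"
  have q: "u \<in> Poly_Mapping.keys p" "u \<noteq> t" if "u \<in> Poly_Mapping.keys q" for u
    using that by (auto simp: q_def a_def in_keys_iff lookup_minus lookup_single when_def split: if_splits)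
  have "t + t \<notin> Poly_Mapping.keys (q * (q + (a + a)))"
  proof
    assume "t + t \<in> Poly_Mapping.keys (q * (q + (a + a)))"
    then obtain u v where uv: "t + t = u + v" "u \<in> Poly_Mapping.keys q"
        "v \<in> Poly_Mapping.keys (q + (a + a))"
      using keys_mult[of q "q + (a + a)"] by blast
    then have "v \<in> Poly_Mapping.keys q \<or> v = t"
      using keys_add[of q "a + a"] keys_add[of a a] by (auto simp: a_def split: if_splits)
    then show False
      using uv q assms by (metis add_right_cancel)
  qed
  then have "Poly_Mapping.lookup (q * (q + (a + a))) (t + t) = 0"
    by (simp add: not_in_keys_iff_lookup_eq_zero)
  moreover have "p\<^sup>2 = a * a + q * (q + (a + a))"
    by (simp add: q_def power2_eq_square algebra_simps)
  moreover have "Poly_Mapping.lookup (a * a) (t + t) = (Poly_Mapping.lookup p t)\<^sup>2"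
    by (simp add: a_def mult_single power2_eq_square)
  ultimately show ?thesis by (simp add: lookup_add)
qed

text \<open>Let \<open>t\<close> be the least monomial for the graded lexicographic order that occurs in some summand.
  Then \<open>t + t\<close> has a positive coefficient in the sum of squares.\<close>

lemma sum_of_squares_low_degree:
  fixes f :: "nat \<Rightarrow> real_mpoly"
  assumes "(\<Sum>i<r. (f i)\<^sup>2) \<in> homogeneous_polynomials (2 * d) n" "i < r" "u \<in> Poly_Mapping.keys (f i)"
  shows "d \<le> monomial_degree u"
proof -
  define T where "T = (\<Union>i<r. Poly_Mapping.keys (f i))"
  define k where "k = Min (monomial_degree ` T)"
  define T' where "T' = {t \<in> T. monomial_degree t = k}"
  \<comment> \<open>Ties in the lowest degree are broken by the linear order on monomials, which is
    compatible with addition.\<close>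
  define t where "t = Min T'"
  have T: "finite T" "u \<in> T" using assms by (auto simp: T_def)
  then have k: "k \<le> monomial_degree s" if "s \<in> T" for s
    using that by (simp add: k_def)
  have "k \<in> monomial_degree ` T" using T unfolding k_def by (intro Min_in) auto
  then have "finite T'" "T' \<noteq> {}" using T by (auto simp: T'_def)
  then have t: "t \<in> T'" "\<And>s. s \<in> T' \<Longrightarrow> t \<le> s" by (auto simp: t_def)
  have ext: "v = t" if vw: "v \<in> T" "w \<in> T" "v + w = t + t" for v w
  proof -
    have "monomial_degree v + monomial_degree w = k + k"
      using vw(3) t(1) monomial_degree_add by (metis (mono_tags, lifting) T'_def mem_Collect_eq)
    with k vw(1,2) have "v \<in> T'" "w \<in> T'"
      by (metis (mono_tags, lifting) T'_def add_le_cancel_right le_antisym mem_Collect_eq add_le_cancel_left)+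
    with t(2) have "t \<le> v" "t \<le> w" by auto
    show "v = t"
    proof (rule ccontr)
      assume "v \<noteq> t"
      with \<open>t \<le> v\<close> have "t < v" by simp
      then have "t + t < v + w" using \<open>t \<le> w\<close> by (rule add_less_le_mono)
      with vw(3) show False by simp
    qed
  qed
  have "Poly_Mapping.lookup (\<Sum>i<r. (f i)\<^sup>2) (t + t) = (\<Sum>i<r. (Poly_Mapping.lookup (f i) t)\<^sup>2)"
    unfolding lookup_sum
  proof (intro sum.cong refl lookup_square_extremal)
    fix j v w
    assume "j \<in> {..<r}" "v \<in> Poly_Mapping.keys (f j)" "w \<in> Poly_Mapping.keys (f j)" "v + w = t + t"
    then show "v = t" by (intro ext[of v w]) (auto simp: T_def)
  qed
  \<comment> \<open>The squares are nonnegative, and one is nonzero because \<open>t\<close> occurs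
    in some \<open>f i\<close>.\<close>
  also have "\<dots> \<noteq> 0"
    using t(1) by (auto simp: T'_def T_def sum_nonneg_eq_0_iff in_keys_iff)
  finally have "t + t \<in> monomials (2 * d) n"
    using assms(1) by (auto simp: homogeneous_polynomials_iff in_keys_iff)
  then have "k = d" using t(1) by (auto simp: monomials_def monomial_degree_add T'_def)
  with k T show ?thesis by auto
qed

lift_definition homogeneous_part :: "nat \<Rightarrow> real_mpoly \<Rightarrow> real_mpoly" is
  "\<lambda>d p t. if monomial_degree t = d then p t else 0"
  by (erule rev_finite_subset) auto

lemma homogeneous_part_homogeneous:
  "p \<in> polynomials n \<Longrightarrow> homogeneous_part d p \<in> homogeneous_polynomials d n"
  by (auto simp: polynomials_def homogeneous_polynomials_iff monomials_def in_keys_iff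
      homogeneous_part.rep_eq split: if_splits)

text \<open>No summand has terms of degree below \<open>d\<close>, so outside its part of degree
  \<open>d\<close> each has only higher ones. These affect the sum only in degrees above
  \<open>2 * d\<close>, where the given form has no terms.\<close>

lemma sum_of_squares_homogeneous_parts:
  fixes f :: "nat \<Rightarrow> real_mpoly"
  assumes "\<And>i. i < r \<Longrightarrow> f i \<in> polynomials n"
    and F: "(\<Sum>i<r. (f i)\<^sup>2) \<in> homogeneous_polynomials (2 * d) n"
  shows "(\<Sum>i<r. (f i)\<^sup>2) = (\<Sum>i<r. (homogeneous_part d (f i))\<^sup>2)"
proof -
  define h where "h = (\<lambda>i. homogeneous_part d (f i))"
  \<comment> \<open>This is \<open>(f i)^2 - (h i)^2\<close>, factored so that the first factor has
    only degrees above \<open>d\<close> and the second only degrees from \<open>d\<close>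
    on.\<close>
  define w where "w = (\<lambda>i. (f i - h i) * ((f i - h i) + (h i + h i)))"
  define W where "W = (\<Sum>i<r. w i)"
  have h: "h i \<in> homogeneous_polynomials d n" if "i < r" for i
    using homogeneous_part_homogeneous assms(1) that by (simp add: h_def)
  have split: "(\<Sum>i<r. (f i)\<^sup>2) = (\<Sum>i<r. (h i)\<^sup>2) + W"
    unfolding W_def sum.distrib[symmetric]
    by (intro sum.cong refl) (simp add: w_def power2_eq_square algebra_simps)
  have "2 * d < monomial_degree s" if s: "s \<in> Poly_Mapping.keys W" for s
  proof -
    obtain i where i: "i < r" "s \<in> Poly_Mapping.keys (w i)"
      using s keys_sum[of w "{..<r}"] by (auto simp: W_def)
    have low: "d < monomial_degree u" if "u \<in> Poly_Mapping.keys (f i - h i)" for u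
    proof -
      have "u \<in> Poly_Mapping.keys (f i)" "monomial_degree u \<noteq> d"
        using that
        by (auto simp: in_keys_iff lookup_minus h_def homogeneous_part.rep_eq split: if_splits)
      with sum_of_squares_low_degree[OF F i(1)] show ?thesis by force
    qed
    obtain u v where uv: "s = u + v" "u \<in> Poly_Mapping.keys (f i - h i)"
        "v \<in> Poly_Mapping.keys ((f i - h i) + (h i + h i))"
      using i(2) keys_mult[of "f i - h i" "(f i - h i) + (h i + h i)"] unfolding w_def by blast
    have "v \<in> Poly_Mapping.keys (f i - h i) \<or> v \<in> Poly_Mapping.keys (h i)"
      using uv(3) keys_add[of "f i - h i" "h i + h i"] keys_add[of "h i" "h i"] by blast
    then have "d \<le> monomial_degree v"
      using low h[OF i(1)] by (fastforce simp: homogeneous_polynomials_iff monomials_def)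
    with low[OF uv(2)] show ?thesis by (simp add: uv(1) monomial_degree_add)
  qed
  moreover have "monomial_degree s = 2 * d" if s: "s \<in> Poly_Mapping.keys W" for s
  proof -
    have "(\<Sum>i<r. (h i)\<^sup>2) \<in> homogeneous_polynomials (2 * d) n"
      using h homogeneous_polynomials_mult[of _ d n _ d]
      by (intro homogeneous_polynomials_sum) (auto simp: power2_eq_square mult_2)
    moreover have "W = (\<Sum>i<r. (f i)\<^sup>2) - (\<Sum>i<r. (h i)\<^sup>2)"
      using split by simp
    ultimately show ?thesis
      using F s keys_diff[of "\<Sum>i<r. (f i)\<^sup>2" "\<Sum>i<r. (h i)\<^sup>2"]
      by (auto simp: homogeneous_polynomials_iff monomials_def)
  qed
  ultimately have "W = 0" by (metis all_not_in_conv keys_eq_empty less_irrefl)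
  with split show ?thesis by (simp add: h_def)
qed

subsection \<open>Length of sums of squares\<close>

lemma products_dependent:
  assumes "\<And>i. i < r \<Longrightarrow> f i \<in> homogeneous_polynomials d n"
    and "(n + 2 * d - 1) choose (2 * d) < r * (r + 1) div 2"
  shows "\<exists>B i0 j0. (\<forall>i j. B i j = B j i) \<and> i0 < r \<and> j0 < r \<and> B i0 j0 \<noteq> 0 \<and>
    (\<Sum>i<r. \<Sum>j<r. Const (B i j) * (f i * f j)) = 0"
proof -
  \<comment> \<open>The pairs with \<open>j \<le> i\<close> list each product
    \<open>f i * f j\<close> once. Their coefficients are the unknowns, and the monomials of degree
    \<open>2 * d\<close> give the equations.\<close>
  define P where "P = Sigma {..<r} (\<lambda>j. {..j})"
  have "card P = (\<Sum>j<r. Suc j)"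
    by (simp add: P_def)
  also have "\<dots> = r * (r + 1) div 2"
    by (induction r) auto
  finally have "card (monomials (2 * d) n) < card P"
    using assms(2) card_monomials_le[of "2 * d" n] by linarith
  then obtain c where c: "\<exists>p\<in>P. c p \<noteq> 0"
    "\<And>t. t \<in> monomials (2 * d) n \<Longrightarrow>
      (\<Sum>p\<in>P. c p * Poly_Mapping.lookup (f (fst p) * f (snd p)) t) = 0"
    using underdetermined_system[OF finite_monomials, of P "2 * d" n
        "\<lambda>p. Poly_Mapping.lookup (f (fst p) * f (snd p))"]
    by (auto simp: P_def)
  have rel: "(\<Sum>p\<in>P. Const (c p) * (f (fst p) * f (snd p))) = 0"
  proof (rule poly_mapping_eqI)
    fix t
    have "(\<Sum>p\<in>P. Const (c p) * (f (fst p) * f (snd p))) \<in> homogeneous_polynomials (2 * d) n"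
      using homogeneous_polynomials_mult[of _ d n _ d] assms(1)
      by (intro homogeneous_polynomials_sum Const_mult_homogeneous) (auto simp: P_def mult_2)
    then show "Poly_Mapping.lookup (\<Sum>p\<in>P. Const (c p) * (f (fst p) * f (snd p))) t =
        Poly_Mapping.lookup 0 t"
      using c(2)[of t]
      by (cases "t \<in> monomials (2 * d) n")
        (auto simp: homogeneous_polynomials_iff lookup_sum lookup_Const_mult in_keys_iff)
  qed
  \<comment> \<open>Symmetrizing the triangular \<open>C\<close> cannot lose the nonzero
    coefficient: off the diagonal at most one summand is nonzero, and on it the value
    doubles.\<close>
  define C where "C = (\<lambda>i j. if j \<le> i then c (i, j) else 0)"
  define B where "B = (\<lambda>i j. C i j + C j i)"
  obtain i0 j0 where ij: "(i0, j0) \<in> P" "c (i0, j0) \<noteq> 0" using c(1) by auto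
  then have ij': "i0 < r" "j0 < r" "B i0 j0 \<noteq> 0"
    by (auto simp: P_def B_def C_def)
  have C: "(\<Sum>i<r. \<Sum>j<r. Const (C i j) * (f i * f j)) = 0"
  proof -
    have "(\<Sum>j<r. Const (C i j) * (f i * f j)) = (\<Sum>j\<le>i. Const (c (i, j)) * (f i * f j))" if "i < r" for i
      using that by (intro sum.mono_neutral_cong_right) (auto simp: C_def Const_0)
    then have "(\<Sum>i<r. \<Sum>j<r. Const (C i j) * (f i * f j)) =
        (\<Sum>i<r. \<Sum>j\<le>i. Const (c (i, j)) * (f i * f j))"
      by simp
    also have "\<dots> = (\<Sum>p\<in>P. Const (c p) * (f (fst p) * f (snd p)))"
      unfolding P_def by (subst sum.Sigma) (auto simp: split_def)
    finally show ?thesis using rel by simp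
  qed
  have "(\<Sum>i<r. \<Sum>j<r. Const (C j i) * (f i * f j)) = (\<Sum>j<r. \<Sum>i<r. Const (C j i) * (f j * f i))"
    by (subst sum.swap) (simp add: mult.commute)
  with C have "(\<Sum>i<r. \<Sum>j<r. Const (B i j) * (f i * f j)) = 0"
    by (simp add: B_def Const_add distrib_right sum.distrib)
  then show ?thesis
    using ij' by (intro exI[of _ B] exI[of _ i0] exI[of _ j0]) (auto simp: B_def)
qed

lemma sum_of_squares_shorten:
  assumes "\<And>i. i < r \<Longrightarrow> f i \<in> homogeneous_polynomials d n"
    and "(n + 2 * d - 1) choose (2 * d) < r * (r + 1) div 2"
  shows "\<exists>g. (\<forall>i<r - 1. g i \<in> homogeneous_polynomials d n) \<and> (\<Sum>i<r. (f i)\<^sup>2) = (\<Sum>i<r - 1. (g i)\<^sup>2)"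
proof -
  obtain B i0 j0 where B: "\<And>i j. B i j = B j i" "i0 < r" "j0 < r" "B i0 j0 \<noteq> 0"
      "(\<Sum>i<r. \<Sum>j<r. Const (B i j) * (f i * f j)) = 0"
    using products_dependent[of r f d n, OF assms] by blast
  obtain t k L where k: "k < r" and
    L: "\<And>i j. i < r \<Longrightarrow> j < r \<Longrightarrow>
      (if i = j then 1 else 0) + t * B i j = (\<Sum>l\<in>{..<r} - {k}. L l i * L l j)"
    using singular_perturbation_gram[of "{..<r}" B i0 j0, OF finite_lessThan B(1)] B(2-4)
    unfolding lessThan_iff Ball_def Bex_def by blast
  \<comment> \<open>In vector notation \<open>h = L f\<close>, so the squares of \<open>h\<close>
    add up to \<open>f^T L^T L f = f^T (I + t B) f\<close>, and the relation given by
    \<open>B\<close> removes the second term.\<close>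
  define h where "h = (\<lambda>l. \<Sum>i<r. Const (L l i) * f i)"
  have h: "h l \<in> homogeneous_polynomials d n" for l
    unfolding h_def using assms(1) by (intro homogeneous_polynomials_sum Const_mult_homogeneous) auto
  have sq: "(h l)\<^sup>2 = (\<Sum>i<r. \<Sum>j<r. Const (L l i * L l j) * (f i * f j))" for l
    by (simp add: h_def power2_eq_square sum_product Const_mult mult_ac)
  have "(\<Sum>l\<in>{..<r} - {k}. (h l)\<^sup>2) =
      (\<Sum>i<r. \<Sum>l\<in>{..<r} - {k}. \<Sum>j<r. Const (L l i * L l j) * (f i * f j))"
    unfolding sq by (rule sum.swap)
  also have "\<dots> = (\<Sum>i<r. \<Sum>j<r. \<Sum>l\<in>{..<r} - {k}. Const (L l i * L l j) * (f i * f j))"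
    by (intro sum.cong refl sum.swap)
  also have "\<dots> = (\<Sum>i<r. \<Sum>j<r. Const ((if i = j then 1 else 0) + t * B i j) * (f i * f j))"
    by (intro sum.cong refl) (simp add: L Const_sum sum_distrib_right)
  also have "\<dots> = (\<Sum>i<r. \<Sum>j<r. Const (if i = j then 1 else 0) * (f i * f j)) +
      Const t * (\<Sum>i<r. \<Sum>j<r. Const (B i j) * (f i * f j))"
    by (simp add: Const_add Const_mult distrib_right sum.distrib sum_distrib_left mult.assoc)
  also have "(\<Sum>i<r. \<Sum>j<r. Const (if i = j then 1 else 0) * (f i * f j)) = (\<Sum>i<r. (f i)\<^sup>2)"
  proof (intro sum.cong refl)
    fix i assume "i \<in> {..<r}"
    have "(\<Sum>j<r. Const (if i = j then 1 else 0) * (f i * f j)) =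
        (\<Sum>j<r. if i = j then (f i)\<^sup>2 else 0)"
      by (intro sum.cong) (auto simp: Const_0 Const_1 power2_eq_square)
    with \<open>i \<in> {..<r}\<close> show "(\<Sum>j<r. Const (if i = j then 1 else 0) * (f i * f j)) = (f i)\<^sup>2"
      by simp
  qed
  finally have F: "(\<Sum>l\<in>{..<r} - {k}. (h l)\<^sup>2) = (\<Sum>i<r. (f i)\<^sup>2)"
    using B(5) by simp
  \<comment> \<open>The remaining rows are renumbered by an initial segment; \<open>k < r\<close>
    makes \<open>r - 1\<close> a genuine decrease.\<close>
  have "card ({..<r} - {k}) = r - 1" using k by simp
  then obtain b where "bij_betw b {..<r - 1} ({..<r} - {k})"
    using ex_bij_betw_nat_finite[of "{..<r} - {k}"] by (auto simp: atLeast0LessThan)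
  then have "(\<Sum>i<r - 1. (h (b i))\<^sup>2) = (\<Sum>l\<in>{..<r} - {k}. (h l)\<^sup>2)"
    by (rule sum.reindex_bij_betw)
  with F h show ?thesis by (intro exI[of _ "h \<circ> b"]) auto
qed

lemma SOS_rank_triangular_le:
  assumes "has_SOS_decomposition (2 * d) n A"
  shows "SOS_rank (2 * d) n A * (SOS_rank (2 * d) n A + 1) div 2 \<le> (n + 2 * d - 1) choose (2 * d)"
proof (rule ccontr)
  define Q where "Q = (\<lambda>r::nat. \<exists>f. (\<forall>i<r. f i \<in> homogeneous_polynomials d n) \<and>
    assoc_form (2 * d) n A = (\<Sum>i<r. (f i)\<^sup>2))"
  define r where "r = SOS_rank (2 * d) n A"
  have r: "r = (LEAST r. Q r)" by (simp add: r_def SOS_rank_def Q_def)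
  obtain s :: nat and f where f: "\<And>i. i < s \<Longrightarrow> f i \<in> polynomials n"
      "assoc_form (2 * d) n A = (\<Sum>i<s. (f i)\<^sup>2)"
    using assms unfolding has_SOS_decomposition_def by blast
  \<comment> \<open>\<open>SOS_rank\<close> is a \<open>LEAST\<close> over homogeneous
    decompositions, so one must exist for it to be attained; the homogeneous parts supply
    it.\<close>
  have "(\<Sum>i<s. (f i)\<^sup>2) = (\<Sum>i<s. (homogeneous_part d (f i))\<^sup>2)"
    using f(1) assoc_form_homogeneous[of "2 * d" n A, unfolded f(2)]
    by (rule sum_of_squares_homogeneous_parts)
  then have "Q s"
    using f homogeneous_part_homogeneous
    unfolding Q_def by (intro exI[of _ "\<lambda>i. homogeneous_part d (f i)"]) auto
  then have "Q r" unfolding r by (rule LeastI)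
  then obtain g where g: "\<And>i. i < r \<Longrightarrow> g i \<in> homogeneous_polynomials d n"
      "assoc_form (2 * d) n A = (\<Sum>i<r. (g i)\<^sup>2)"
    unfolding Q_def by blast
  assume "\<not> ?thesis"
  then have big: "(n + 2 * d - 1) choose (2 * d) < r * (r + 1) div 2" by (simp add: r_def)
  from sum_of_squares_shorten[of r g d n, OF g(1) this] have "Q (r - 1)"
    unfolding Q_def g(2) by blast
  then have "r \<le> r - 1" unfolding r by (rule Least_le)
  \<comment> \<open>In truncated subtraction \<open>r \<le> r - 1\<close> leaves only
    \<open>r = 0\<close>, which \<open>big\<close> excludes.\<close>
  with big show False by (cases r) simp_all
qed

theorem proposition4p1:
  fixes m n a :: nat and \<Lambda> :: real
  assumes "even m"
    and "a = (n + m - 1) choose m"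
    and "\<Lambda> = (sqrt (1 + 8 * real a) - 1) / 2"
  shows "(\<forall>A \<in> symmetric_tensors m n. has_SOS_decomposition m n A \<longrightarrow> real (SOS_rank m n A) \<le> \<Lambda>)
    \<and> SOS_width m n (SOS_tensors m n) \<le> ereal \<Lambda>"
proof -
  have *: "real (SOS_rank m n A) \<le> \<Lambda>" if "has_SOS_decomposition m n A" for A
  proof -
    define r where "r = SOS_rank m n A"
    obtain d where m: "m = 2 * d" using assms(1) by (rule evenE)
    have "r * (r + 1) div 2 \<le> a"
      using SOS_rank_triangular_le[of d n A] that by (simp add: m r_def assms(2))
    \<comment> \<open>Parity makes the division by two exact.\<close>
    moreover have "even (r * (r + 1))" by simp
    ultimately have "r * (r + 1) \<le> 2 * a" by (metis dvd_mult_div_cancel mult_le_mono2)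
    then have "real r * (real r + 1) \<le> 2 * real a"
      by (metis of_nat_le_iff of_nat_mult of_nat_add of_nat_1 of_nat_numeral)
    \<comment> \<open>Multiplying by four and adding one completes the square.\<close>
    then have "(2 * real r + 1)\<^sup>2 \<le> 1 + 8 * real a"
      by (simp add: power2_eq_square algebra_simps)
    then have "2 * real r + 1 \<le> sqrt (1 + 8 * real a)" by (rule real_le_rsqrt)
    then show ?thesis by (simp add: assms(3) r_def)
  qed
  then have "SOS_width m n (SOS_tensors m n) \<le> ereal \<Lambda>"
    unfolding SOS_width_def by (intro SUP_least) (auto simp: SOS_tensors_def)
  with * show ?thesis by blast
qed

end
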